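(* Let $R$ be an integrally closed domain and $X$ an indeterminate over $R$. Then $R$ has finite $t$-character if and only if $R[X]$ has finite $t$-character.
   Context: All rings are integral domains. For a domain $A$ with quotient field $F$ and a nonzero fractional ideal $I$ of $A$, put $I^{-1}=\{x\in F : xI\subseteq A\}$, $I_v=(I^{-1})^{-1}$, and $I_t=\bigcup J_v$, where $J$ ranges over the nonzero finitely generated fractional ideals contained in $I$. $I$ is a $t$-ideal if it is nonzero and $I_t=I$. A $t$-maximal ideal is a maximal element of the set of proper integral $t$-ideals of $A$. $A$ has finite $t$-character if each nonzero nonunit of $A$ is contained in only finitely many $t$-maximal ideals of $A$. *)

theory Defs
  imports "HOL-Computational_Algebra.Polynomial_Factorial"
begin

text \<open>
  A domain $A$ is a type \<open>'a :: idom\<close>, its quotient field is \<open>'a fract\<close>, and $A$ is identified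
  with the subring \<open>range to_fract\<close>. All ideals, integral ones included, are subsets of the
  quotient field.
\<close>

definition fract_scale :: "'a::idom \<Rightarrow> 'a fract \<Rightarrow> 'a fract"
  where "fract_scale a x = to_fract a * x"

global_interpretation fract: module fract_scale
  by unfold_locales (simp_all add: fract_scale_def algebra_simps)

definition fractional_ideal :: "'a::idom fract set \<Rightarrow> bool" where
  "fractional_ideal I \<longleftrightarrow>
     fract.subspace I \<and> (\<exists>d::'a. d \<noteq> 0 \<and> (\<forall>x\<in>I. to_fract d * x \<in> range to_fract))"

definition fg_fractional_ideal :: "'a::idom fract set \<Rightarrow> bool" where
  "fg_fractional_ideal J \<longleftrightarrow> fractional_ideal J \<and> (\<exists>S. finite S \<and> J = fract.span S)"

definition ideal_inv :: "'a::idom fract set \<Rightarrow> 'a fract set" where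
  "ideal_inv I = {x. \<forall>y\<in>I. x * y \<in> range to_fract}"

definition v_closure :: "'a::idom fract set \<Rightarrow> 'a fract set" where
  "v_closure I = ideal_inv (ideal_inv I)"

definition t_closure :: "'a::idom fract set \<Rightarrow> 'a fract set" where
  "t_closure I = \<Union> {v_closure J | J. fg_fractional_ideal J \<and> J \<noteq> {0} \<and> J \<subseteq> I}"

definition t_ideal :: "'a::idom fract set \<Rightarrow> bool" where
  "t_ideal I \<longleftrightarrow> fractional_ideal I \<and> I \<noteq> {0} \<and> t_closure I = I"

definition proper_integral_t_ideal :: "'a::idom fract set \<Rightarrow> bool" where
  "proper_integral_t_ideal I \<longleftrightarrow> t_ideal I \<and> I \<subset> range to_fract"

definition t_maximal_ideal :: "'a::idom fract set \<Rightarrow> bool" where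
  "t_maximal_ideal M \<longleftrightarrow> proper_integral_t_ideal M \<and>
     (\<forall>N. proper_integral_t_ideal N \<longrightarrow> M \<subseteq> N \<longrightarrow> N = M)"

definition finite_t_character :: "'a::idom itself \<Rightarrow> bool" where
  "finite_t_character (_ :: 'a itself) \<longleftrightarrow>
     (\<forall>a::'a. a \<noteq> 0 \<longrightarrow> \<not> a dvd 1 \<longrightarrow> finite {M. t_maximal_ideal M \<and> to_fract a \<in> M})"

definition integral_over_domain :: "'a::idom fract \<Rightarrow> bool" where
  "integral_over_domain x \<longleftrightarrow> (\<exists>p::'a poly. lead_coeff p = 1 \<and> poly (fract_poly p) x = 0)"

definition integrally_closed :: "'a::idom itself \<Rightarrow> bool" where
  "integrally_closed (_ :: 'a itself) \<longleftrightarrow>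
     (\<forall>x::'a fract. integral_over_domain x \<longrightarrow> x \<in> range to_fract)"

end

theory Submission
  imports Defs "Jordan_Normal_Form.Char_Poly"
begin

text \<open>
  Write $R$ for the integrally closed domain and $M[X]$ for the set of polynomials with all
  coefficients in $M$. The maximal t-ideals of $R[X]$ are of two kinds: the extensions $M[X]$ of
  maximal t-ideals $M$ of $R$, and some ideals that meet $R$ only in $0$. A nonzero polynomial $f$
  lies in finitely many of the second kind, and it lies in $M[X]$ only if its leading coefficient
  lies in $M$. Hence finiteness for $R$ gives finiteness for $R[X]$.
  Conversely $M \mapsto M[X]$ is injective and $M[X]$ contains the constant $a$ exactly if $M$ contains $a$,
  so finiteness for $R[X]$ gives finiteness for $R$.

  All of this is about integral ideals, so the quotient field can be eliminated. An element $c/d$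
  carries $s$ into the ring if and only if $d$ divides $cs$; hence $x$ lies in $(S)_v$ if and only if
  $d \mid cx$ whenever $d \mid cs$ for every $s \in S$. This is \<open>divisorial_hull\<close>, and
  \<open>finite_t_character_iff\<close> restates the problem with it.

  Integral closedness enters through \<open>const_dvd_mult_imp_dvd_coeff_mult\<close>: if $a \neq 0$ in
  $R$ divides $fg$ then $a$ divides every product of a coefficient of $f$ and a coefficient of $g$.
  By the Dedekind-Mertens lemma $c(f)^{m+1} c(g) \subseteq c(f)^m c(fg)$, where $c$ denotes the
  content ideal and $m$ the degree of $g$, such a product divided by $a$ maps the finitely generated
  module $c(f)^m$ into itself, so it is integral over $R$ and thus in $R$.

  Now let $Q$ be a proper t-ideal of $R[X]$ that contains a nonzero constant $a$. The coefficients of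
  its members generate an ideal $C$ whose t-closure is still proper
  (\<open>t_ideal_with_constant_le_poly_extension\<close>): if finitely many coefficients, of
  $f_1, \dots, f_k \in Q$, had divisorial hull $R$, then so would $a, f_1, \dots, f_k$ in $R[X]$,
  because a fraction $u$ with $ua$ and all $u f_i$ in $R[X]$ is a polynomial over the quotient field
  of $R$, and its coefficients multiply those of the $f_i$ into $R$, so that they lie in $R$. Then
  $1 \in Q$, a contradiction. So $Q \subseteq N[X]$ for a proper t-ideal $N$ of $R$, which yields both that $M[X]$ is maximal for maximal $M$ and that a maximal $Q$ is of the form $N[X]$.

  Finally, maximal t-ideals are prime, since $(Q : p)$ is again a proper t-ideal for
  $p \notin Q$. If $Q$ is a maximal
  t-ideal of $R[X]$ with $Q \cap R = 0$ that contains $f$, pick a nonzero $p \in Q$ of least degree. Pseudo-division gives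
  $bf = pf'$ with $b \neq 0$ in $R$ and $f'$ of smaller degree, and every other such ideal contains
  $f'$. Induction on the degree shows that there are finitely many
  (\<open>finite_maximal_t_ideals_over_zero\<close>).
\<close>

section \<open>Ideals\<close>

definition ideal_of_ring :: "'a::comm_ring_1 set \<Rightarrow> bool" where
  "ideal_of_ring I \<longleftrightarrow> 0 \<in> I \<and> (\<forall>x\<in>I. \<forall>y\<in>I. x + y \<in> I) \<and> (\<forall>r. \<forall>x\<in>I. r * x \<in> I)"

lemma ideal_of_ringI:
  assumes "0 \<in> I" "\<And>x y. x \<in> I \<Longrightarrow> y \<in> I \<Longrightarrow> x + y \<in> I" "\<And>r x. x \<in> I \<Longrightarrow> r * x \<in> I"
  shows "ideal_of_ring I"
  using assms by (auto simp: ideal_of_ring_def)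

lemma ideal_of_ringD:
  assumes "ideal_of_ring I"
  shows ideal_zero: "0 \<in> I"
    and ideal_add: "\<And>x y. x \<in> I \<Longrightarrow> y \<in> I \<Longrightarrow> x + y \<in> I"
    and ideal_mult: "\<And>r x. x \<in> I \<Longrightarrow> r * x \<in> I"
    and ideal_diff: "\<And>x y. x \<in> I \<Longrightarrow> y \<in> I \<Longrightarrow> x - y \<in> I"
proof -
  show "0 \<in> I" and add: "\<And>x y. x \<in> I \<Longrightarrow> y \<in> I \<Longrightarrow> x + y \<in> I"
    and mult: "\<And>r x. x \<in> I \<Longrightarrow> r * x \<in> I"
    using assms by (auto simp: ideal_of_ring_def)
  show "x - y \<in> I" if "x \<in> I" "y \<in> I" for x y
    using add[OF that(1) mult[OF that(2), of "-1"]] by simp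
qed

lemma ideal_of_ring_colon:
  assumes "ideal_of_ring I"
  shows "ideal_of_ring {x. b * x \<in> I}"
proof (rule ideal_of_ringI)
  show "0 \<in> {x. b * x \<in> I}" using ideal_zero[OF assms] by simp
  show "x + y \<in> {x. b * x \<in> I}" if "x \<in> {x. b * x \<in> I}" "y \<in> {x. b * x \<in> I}" for x y
    using that ideal_add[OF assms] by (simp add: distrib_left)
  show "r * x \<in> {x. b * x \<in> I}" if "x \<in> {x. b * x \<in> I}" for r x
    using that ideal_mult[OF assms, of "b * x" r] by (simp add: mult.left_commute)
qed

section \<open>The Dedekind-Mertens lemma\<close>

primrec products_of :: "'a::comm_ring_1 set \<Rightarrow> nat \<Rightarrow> 'a set" where
  "products_of A 0 = {1}"
| "products_of A (Suc m) = {a * t | a t. a \<in> A \<and> t \<in> products_of A m}"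

lemma products_of_mono: "A \<subseteq> B \<Longrightarrow> products_of A m \<subseteq> products_of B m"
  by (induction m) auto

lemma finite_products_of: "finite A \<Longrightarrow> finite (products_of A m)"
proof (induction m)
  case (Suc m)
  have "products_of A (Suc m) = (\<lambda>(a, t). a * t) ` (A \<times> products_of A m)" by auto
  then show ?case using Suc by simp
qed simp

lemma power_in_products_of: "a \<in> A \<Longrightarrow> a ^ m \<in> products_of A m"
  by (induction m) auto

text \<open>
  Sorts the products of elements of \<open>A\<close> by whether the generator \<open>b\<close> occurs in them. This is
  how the induction on the number of coefficients of \<open>f\<close> below splits powers of the content ideal.
\<close>
lemma products_of_cases:
  assumes "A \<subseteq> insert b A'" and "t \<in> products_of A (Suc m)"
  shows "(\<exists>s\<in>products_of A m. t = b * s) \<or> t \<in> products_of A' (Suc m)"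
  using assms(2)
proof (induction m arbitrary: t)
  case 0
  then show ?case using assms(1) by auto
next
  case (Suc m)
  from Suc.prems obtain a t' where t: "t = a * t'" and a: "a \<in> A" and t': "t' \<in> products_of A (Suc m)"
    by auto
  show ?case
  proof (cases "a = b")
    case True
    then show ?thesis using t t' by blast
  next
    case False
    with a assms(1) have a': "a \<in> A'" by blast
    from Suc.IH[OF t'] show ?thesis
    proof
      assume "\<exists>s\<in>products_of A m. t' = b * s"
      then obtain s where "s \<in> products_of A m" "t' = b * s" by blast
      then have "a * s \<in> products_of A (Suc m)" "t = b * (a * s)" using a t by (auto simp: ac_simps)
      then show ?thesis by blast
    next
      assume "t' \<in> products_of A' (Suc m)"
      then have "a * t' \<in> products_of A' (Suc (Suc m))" using a' by (simp only: products_of.simps(2)[of A' "Suc m"]) blast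
      then show ?thesis using t by simp
    qed
  qed
qed

lemma coeff_mult_top:
  fixes f g :: "'a::comm_ring_1 poly"
  assumes "\<And>i. i > n \<Longrightarrow> coeff f i = 0" "\<And>j. j > m \<Longrightarrow> coeff g j = 0"
  shows "coeff (f * g) (n + m) = coeff f n * coeff g m"
proof (cases "degree f = n \<and> degree g = m")
  case True
  then show ?thesis using coeff_mult_degree_sum[of f g] by simp
next
  case False
  have "degree f \<le> n" "degree g \<le> m" using assms by (simp_all add: degree_le)
  with False have "degree f < n \<or> degree g < m" by linarith
  then have "coeff f n * coeff g m = 0" by (auto simp: coeff_eq_0)
  moreover have "degree (f * g) < n + m"
    using degree_mult_le[of f g] False \<open>degree f \<le> n\<close> \<open>degree g \<le> m\<close> by linarith
  ultimately show ?thesis by (simp add: coeff_eq_0)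
qed

text \<open>
  The inclusion $c(f)^m c(g) \subseteq c(f)^{m-1} c(fg)$ for a polynomial $g$ with at most $m$
  coefficients. It is phrased as a statement about every ideal \<open>I\<close> that contains the right-hand side,
  because the induction has to replace \<open>I\<close> by the colon ideal of a coefficient.

  Let $b$ be the top coefficient of $f$. Multiplied by $b$, removing the top term of $g$ is harmless:
  it changes $b \cdot fg$ by multiples of the top coefficient of $fg$, with coefficients of $f$ as
  factors, so the hypothesis for one coefficient less holds for $(I : b)$. This settles the products in $c(f)^m$
  that involve $b$. The remaining ones are products of coefficients of $f$ without its top term, and
  removing this term changes $fg$ by $b$ times a shift of $g$, which has just been dealt with.
\<close>
lemma dedekind_mertens:
  fixes f g :: "'a::comm_ring_1 poly"
  assumes "\<And>i. i \<ge> n \<Longrightarrow> coeff f i = 0" and "\<And>j. j \<ge> m \<Longrightarrow> coeff g j = 0"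
    and "ideal_of_ring I"
    and "\<And>s k. s \<in> products_of (range (coeff f)) (m - 1) \<Longrightarrow> s * coeff (f * g) k \<in> I"
    and "t \<in> products_of (range (coeff f)) m"
  shows "t * coeff g j \<in> I"
  using assms
proof (induction m arbitrary: n f g I t j)
  case 0
  then show ?case by (simp add: ideal_zero)
next
  case (Suc m)
  note IH_m = Suc.IH
  from Suc.prems show ?case
  proof (induction n arbitrary: f I t j)
    case 0
    then have "range (coeff f) = {0}" by auto
    with "0.prems"(5) have "t = 0" by auto
    then show ?case using "0.prems"(3) by (simp add: ideal_zero)
  next
    case (Suc n)
    note I = Suc.prems(3)
    define A where "A = range (coeff f)"
    define b where "b = coeff f n"
    have H: "s * coeff (f * g) k \<in> I" if "s \<in> products_of A m" for s k
      using Suc.prems(4)[of s k] that by (simp add: A_def)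
    have bA: "b \<in> A" by (simp add: A_def b_def)
    have top: "coeff (f * g) (n + m) = b * coeff g m"
      unfolding b_def by (rule coeff_mult_top) (use Suc.prems(1,2) in auto)
    (* The products that contain the top coefficient b of f. *)
    have lead: "b * s * coeff g j \<in> I" if s: "s \<in> products_of A m" for s j
    proof (cases j m rule: linorder_cases)
      case greater
      then show ?thesis using Suc.prems(2) ideal_zero[OF I] by simp
    next
      case equal
      then show ?thesis using H[OF s, of "n + m"] top by (simp add: ac_simps)
    next
      case less
      define g' where "g' = g - monom (coeff g m) m"
      have "s * coeff g' j \<in> {x. b * x \<in> I}"
      proof (rule IH_m)
        show "coeff f i = 0" if "i \<ge> Suc n" for i using Suc.prems(1) that .
        show "coeff g' i = 0" if "i \<ge> m" for i
          using Suc.prems(2)[of i] that by (auto simp: g'_def)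
        show "ideal_of_ring {x. b * x \<in> I}" by (rule ideal_of_ring_colon[OF I])
        show "s \<in> products_of (range (coeff f)) m" using s by (simp add: A_def)
      next
        fix s' k assume "s' \<in> products_of (range (coeff f)) (m - 1)"
        then have s': "s' \<in> products_of A (m - 1)" by (simp add: A_def)
        have bs': "b * s' \<in> products_of A m"
          using less s' bA by (cases m) auto
        (* Since s' has one factor less than the hypothesis H allows for, a coefficient of f may be
           moved over to it; m > 0 is needed for this, and holds as j < m. *)
        have cs': "coeff f i * s' \<in> products_of A m" for i
          using less s' by (cases m) (auto simp: A_def)
        have "f * g' = f * g - monom (coeff g m) m * f" by (simp add: g'_def algebra_simps)
        then have c: "coeff (f * g') k = coeff (f * g) k
            - (if k < m then 0 else coeff g m * coeff f (k - m))"
          by (simp add: coeff_monom_mult not_less)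
        have "b * (s' * coeff (f * g') k)
            = b * s' * coeff (f * g) k
              - (if k < m then 0 else coeff f (k - m) * s' * coeff (f * g) (n + m))"
          unfolding c by (simp add: top right_diff_distrib mult_ac)
        also have "\<dots> \<in> I"
          using H[OF bs'] H[OF cs'] ideal_zero[OF I] by (intro ideal_diff[OF I]) auto
        finally show "s' * coeff (f * g') k \<in> {x. b * x \<in> I}" by simp
      qed
      then show ?thesis using less by (simp add: g'_def mult.assoc)
    qed
    (* The products that avoid b are products of coefficients of f without its top term. *)
    define f' where "f' = f - monom b n"
    define A' where "A' = range (coeff f')"
    have f'0: "coeff f' i = 0" if "i \<ge> n" for i
      using Suc.prems(1)[of i] that by (cases "i = n") (auto simp: f'_def b_def)
    have AA': "A \<subseteq> insert b A'"
    proof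
      fix x assume "x \<in> A"
      then obtain i where "x = coeff f i" by (auto simp: A_def)
      then show "x \<in> insert b A'"
        by (cases "i = n") (auto simp: A'_def f'_def b_def intro!: image_eqI[of _ _ i])
    qed
    have A'A: "A' \<subseteq> A"
    proof
      fix x assume "x \<in> A'"
      then obtain i where i: "x = coeff f' i" by (auto simp: A'_def)
      show "x \<in> A"
      proof (cases "i < n")
        case True
        then show ?thesis using i by (auto simp: A_def f'_def)
      next
        case False
        then have "x = coeff f (Suc n)" using i f'0[of i] Suc.prems(1)[of "Suc n"] by simp
        then show ?thesis by (simp add: A_def)
      qed
    qed
    have "t \<in> products_of A (Suc m)" using Suc.prems(5) by (simp only: A_def)
    from products_of_cases[OF AA' this] show ?case
    proof
      assume "\<exists>s\<in>products_of A m. t = b * s"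
      then show ?thesis using lead by auto
    next
      assume t: "t \<in> products_of A' (Suc m)"
      show ?thesis
      proof (rule Suc.IH[OF f'0 Suc.prems(2) I])
        show "t \<in> products_of (range (coeff f')) (Suc m)" using t by (simp only: A'_def)
      next
        fix s k assume "s \<in> products_of (range (coeff f')) (Suc m - 1)"
        then have s: "s \<in> products_of A m"
          using products_of_mono[OF A'A, of m] by (auto simp: A'_def)
        have "f' * g = f * g - monom b n * g" by (simp add: f'_def algebra_simps)
        then have c: "coeff (f' * g) k = coeff (f * g) k
            - (if k < n then 0 else b * coeff g (k - n))"
          by (simp add: coeff_monom_mult not_less)
        have "s * coeff (f' * g) k
            = s * coeff (f * g) k - (if k < n then 0 else b * s * coeff g (k - n))"
          unfolding c by (simp add: algebra_simps)
        also have "\<dots> \<in> I"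
          using H[OF s] lead[OF s] ideal_zero[OF I] by (intro ideal_diff[OF I]) auto
        finally show "s * coeff (f' * g) k \<in> I" .
      qed
    qed
  qed
qed

section \<open>Products of coefficients over an integrally closed domain\<close>

lemma to_fract_comm_ring_hom: "comm_ring_hom (to_fract :: 'a::idom \<Rightarrow> 'a fract)"
  by unfold_locales simp_all

text \<open>
  The relations say that multiplication by $y/a$ maps the module generated by \<open>T\<close> to itself. They
  exhibit $y/a$ as an eigenvalue of a square matrix over the ring, whose characteristic
  polynomial is monic.
\<close>
lemma determinant_trick:
  fixes y a :: "'a::idom"
  assumes closed: "integrally_closed TYPE('a)"
    and T: "finite T" "t0 \<in> T" "t0 \<noteq> 0" and a: "a \<noteq> 0"
    and stable: "\<And>t. t \<in> T \<Longrightarrow> \<exists>r. y * t = a * (\<Sum>s\<in>T. r s * s)"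
  shows "a dvd y"
proof -
  interpret to_fract: comm_ring_hom "to_fract :: 'a \<Rightarrow> 'a fract"
    by (rule to_fract_comm_ring_hom)
  obtain r where r: "\<And>t. t \<in> T \<Longrightarrow> y * t = a * (\<Sum>s\<in>T. r t s * s)"
    using stable by metis
  obtain ts where ts: "set ts = T" "distinct ts"
    using finite_distinct_list[OF T(1)] by blast
  define n where "n = length ts"
  define A where "A = mat n n (\<lambda>(i, j). r (ts ! i) (ts ! j))"
  define v where "v = vec n (\<lambda>i. to_fract (ts ! i))"
  define k where "k = to_fract y / to_fract a"
  define B where "B = map_mat to_fract A"
  have A: "A \<in> carrier_mat n n" by (simp add: A_def)
  then have B: "B \<in> carrier_mat n n" by (simp add: B_def)
  have sum_ts: "(\<Sum>j<n. h (ts ! j)) = (\<Sum>s\<in>T. h s)" for h :: "'a \<Rightarrow> 'a"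
    using ts by (intro sum.reindex_bij_betw bij_betw_nth) (simp_all add: n_def)
  have "B *\<^sub>v v = k \<cdot>\<^sub>v v"
  proof (rule eq_vecI)
    fix i assume "i < dim_vec (k \<cdot>\<^sub>v v)"
    then have i: "i < n" by (simp add: v_def)
    then have tsi: "ts ! i \<in> T" using ts by (auto simp: n_def)
    have "(B *\<^sub>v v) $ i = (\<Sum>j<n. to_fract (r (ts ! i) (ts ! j)) * to_fract (ts ! j))"
      using i A by (simp add: B_def A_def v_def scalar_prod_def atLeast0LessThan)
    also have "\<dots> = to_fract (\<Sum>j<n. r (ts ! i) (ts ! j) * ts ! j)" by simp
    also have "\<dots> = to_fract (\<Sum>s\<in>T. r (ts ! i) s * s)" using sum_ts[of "\<lambda>s. r (ts ! i) s * s"] by simp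
    also have "\<dots> = k * to_fract (ts ! i)"
      using arg_cong[OF r[OF tsi], of to_fract] a by (simp add: k_def field_simps)
    finally show "(B *\<^sub>v v) $ i = (k \<cdot>\<^sub>v v) $ i" using i by (simp add: v_def)
  qed (use B in \<open>simp add: v_def\<close>)
  moreover have "v \<noteq> 0\<^sub>v n"
  proof
    assume v0: "v = 0\<^sub>v n"
    obtain i where "i < n" "ts ! i = t0" using T(2) ts(1) by (metis in_set_conv_nth n_def)
    then show False using arg_cong[OF v0, of "\<lambda>v. v $ i"] T(3) by (simp add: v_def)
  qed
  ultimately have "eigenvalue B k"
    unfolding eigenvalue_def eigenvector_def using B by (intro exI[of _ v]) (auto simp: v_def)
  then have "poly (char_poly B) k = 0" using eigenvalue_root_char_poly[OF B] by simp
  then have "poly (fract_poly (char_poly A)) k = 0"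
    by (simp add: B_def to_fract.char_poly_hom[OF A])
  moreover have "lead_coeff (char_poly A) = 1" using degree_monic_char_poly[OF A] by simp
  ultimately have "k \<in> range to_fract"
    using closed unfolding integrally_closed_def integral_over_domain_def by blast
  then obtain z where "k = to_fract z" by blast
  then have "to_fract y = to_fract (a * z)" using a by (simp add: k_def field_simps)
  then show ?thesis by (simp only: to_fract_eq_iff) simp
qed

lemma finite_range_coeff: "finite (range (coeff p))"
proof -
  have "range (coeff p) \<subseteq> insert 0 (coeff p ` {..degree p})"
  proof
    fix x assume "x \<in> range (coeff p)"
    then obtain i where "x = coeff p i" by auto
    then show "x \<in> insert 0 (coeff p ` {..degree p})"
      by (cases "i \<le> degree p") (auto simp: coeff_eq_0)
  qed
  then show ?thesis by (rule finite_subset) simp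
qed

text \<open>
  Gauss's lemma for integrally closed domains. The determinant trick is applied to the products of
  $m$ coefficients of $f$, where $m$ is the degree of $g$; with one factor $f_i$ more, they are
  multiplied by $g_j$ into $c(f)^m c(fg)$, hence into $a c(f)^m$, by the Dedekind-Mertens lemma.
\<close>
lemma const_dvd_mult_imp_dvd_coeff_mult:
  fixes f g :: "'a::idom poly"
  assumes closed: "integrally_closed TYPE('a)" and a: "a \<noteq> 0" and dvd: "[:a:] dvd f * g"
  shows "a dvd coeff f i * coeff g j"
proof (cases "f = 0")
  case False
  define A where "A = range (coeff f)"
  define T where "T = products_of A (degree g)"
  define I where "I = range (\<lambda>r. a * (\<Sum>s\<in>T. r s * s))"
  have finT: "finite T" by (simp add: T_def A_def finite_products_of finite_range_coeff)
  have I: "ideal_of_ring I"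
  proof (rule ideal_of_ringI)
    show "0 \<in> I" unfolding I_def by (rule image_eqI[of _ _ "\<lambda>_. 0"]) simp_all
    show "x + y \<in> I" if xI: "x \<in> I" and yI: "y \<in> I" for x y
    proof -
      from xI obtain p where p: "x = a * (\<Sum>s\<in>T. p s * s)" by (auto simp: I_def)
      from yI obtain q where q: "y = a * (\<Sum>s\<in>T. q s * s)" by (auto simp: I_def)
      show ?thesis unfolding I_def
        by (rule image_eqI[of _ _ "\<lambda>s. p s + q s"]) (simp_all add: p q algebra_simps sum.distrib)
    qed
    show "c * x \<in> I" if xI: "x \<in> I" for c x
    proof -
      from xI obtain p where p: "x = a * (\<Sum>s\<in>T. p s * s)" by (auto simp: I_def)
      show ?thesis unfolding I_def
        by (rule image_eqI[of _ _ "\<lambda>s. c * p s"]) (simp_all add: p sum_distrib_left ac_simps)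
    qed
  qed
  have H: "s * coeff (f * g) k \<in> I" if s: "s \<in> T" for s k
  proof -
    from dvd obtain h where "coeff (f * g) k = a * h"
      unfolding const_poly_dvd_iff by (meson dvdE)
    then show ?thesis unfolding I_def
      by (intro image_eqI[of _ _ "\<lambda>s'. if s' = s then h else 0"])
        (use s finT in \<open>simp_all add: if_distrib[of "\<lambda>z. z * _"] cong: if_cong\<close>)
  qed
  have "\<exists>r. (coeff f i * coeff g j) * t = a * (\<Sum>s\<in>T. r s * s)" if t: "t \<in> T" for t
  proof -
    have "coeff f i * t \<in> products_of A (Suc (degree g))"
      using t by (auto simp: T_def A_def)
    then have "(coeff f i * t) * coeff g j \<in> I"
      using dedekind_mertens[of "Suc (degree f)" f "Suc (degree g)" g I "coeff f i * t" j] I H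
      by (simp add: T_def A_def coeff_eq_0 Suc_le_eq)
    then show ?thesis by (auto simp: I_def ac_simps)
  qed
  moreover have "lead_coeff f ^ degree g \<in> T" unfolding T_def A_def by (rule power_in_products_of) blast
  ultimately show ?thesis
    using determinant_trick[OF closed finT, of "lead_coeff f ^ degree g" a] False a by auto
qed simp


section \<open>Divisorial hulls and t-ideals inside the ring\<close>

text \<open>
  The v-closure of the ideal generated by \<open>S\<close>: the pair \<open>c\<close>, \<open>d\<close> stands for the element $c/d$ of
  the quotient field, and the condition says that $c/d \in (S)^{-1}$ implies $(c/d)x \in A$.
\<close>
definition divisorial_hull :: "'a::idom set \<Rightarrow> 'a set" where
  "divisorial_hull S = {x. \<forall>c d. d \<noteq> 0 \<longrightarrow> (\<forall>s\<in>S. d dvd c * s) \<longrightarrow> d dvd c * x}"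

lemma divisorial_hullI:
  "(\<And>c d. d \<noteq> 0 \<Longrightarrow> (\<And>s. s \<in> S \<Longrightarrow> d dvd c * s) \<Longrightarrow> d dvd c * x) \<Longrightarrow> x \<in> divisorial_hull S"
  by (auto simp: divisorial_hull_def)

lemma divisorial_hullD:
  "x \<in> divisorial_hull S \<Longrightarrow> d \<noteq> 0 \<Longrightarrow> (\<And>s. s \<in> S \<Longrightarrow> d dvd c * s) \<Longrightarrow> d dvd c * x"
  by (auto simp: divisorial_hull_def)

lemma divisorial_hull_superset: "S \<subseteq> divisorial_hull S"
  by (auto simp: divisorial_hull_def)

lemma divisorial_hull_mono: "S \<subseteq> T \<Longrightarrow> divisorial_hull S \<subseteq> divisorial_hull T"
  unfolding divisorial_hull_def by blast

lemma divisorial_hull_idem: "T \<subseteq> divisorial_hull S \<Longrightarrow> divisorial_hull T \<subseteq> divisorial_hull S"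
  unfolding divisorial_hull_def by blast

lemma ideal_divisorial_hull: "ideal_of_ring (divisorial_hull S)"
  by (rule ideal_of_ringI) (auto simp: divisorial_hull_def distrib_left mult.left_commute dvd_mult)

text \<open>
  The exclusion of \<open>S \<subseteq> {0}\<close> mirrors the restriction to nonzero finitely generated ideals in the
  definition of the t-closure.
\<close>
definition proper_t_ideal :: "'a::idom set \<Rightarrow> bool" where
  "proper_t_ideal I \<longleftrightarrow> ideal_of_ring I \<and> I \<noteq> {0} \<and> 1 \<notin> I \<and>
     (\<forall>S. finite S \<longrightarrow> S \<subseteq> I \<longrightarrow> \<not> S \<subseteq> {0} \<longrightarrow> divisorial_hull S \<subseteq> I)"

definition maximal_t_ideal :: "'a::idom set \<Rightarrow> bool" where
  "maximal_t_ideal M \<longleftrightarrow> proper_t_ideal M \<and> (\<forall>N. proper_t_ideal N \<longrightarrow> M \<subseteq> N \<longrightarrow> N = M)"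

lemma maximal_t_ideal_proper: "maximal_t_ideal M \<Longrightarrow> proper_t_ideal M"
  by (simp add: maximal_t_ideal_def)

lemma proper_t_ideal_ideal: "proper_t_ideal I \<Longrightarrow> ideal_of_ring I"
  by (simp add: proper_t_ideal_def)

lemma proper_t_ideal_one: "proper_t_ideal I \<Longrightarrow> 1 \<notin> I"
  by (simp add: proper_t_ideal_def)

lemma proper_t_ideal_hull:
  assumes "proper_t_ideal I" "finite S" "S \<subseteq> I" "s \<in> S" "s \<noteq> 0" "x \<in> divisorial_hull S"
  shows "x \<in> I"
  using assms unfolding proper_t_ideal_def by blast

lemma proper_t_ideal_nonzero:
  assumes "proper_t_ideal I"
  obtains x where "x \<in> I" "x \<noteq> 0"
  using assms ideal_zero[of I] unfolding proper_t_ideal_def by auto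

lemma maximal_t_ideal_eq: "maximal_t_ideal M \<Longrightarrow> proper_t_ideal N \<Longrightarrow> M \<subseteq> N \<Longrightarrow> N = M"
  by (simp add: maximal_t_ideal_def)

text \<open>
  Multiplication by \<open>p\<close> maps the hull of \<open>S\<close> into the hull of \<open>p S\<close>, which stays inside \<open>Q\<close>.
\<close>
lemma proper_t_ideal_colon:
  assumes Q: "proper_t_ideal Q" and p: "p \<notin> Q"
  shows "proper_t_ideal {g. p * g \<in> Q}"
proof -
  have I: "ideal_of_ring Q" by (rule proper_t_ideal_ideal[OF Q])
  have p0: "p \<noteq> 0" using p ideal_zero[OF I] by auto
  obtain z where z: "z \<in> Q" "z \<noteq> 0" using proper_t_ideal_nonzero[OF Q] .
  have "divisorial_hull S \<subseteq> {g. p * g \<in> Q}"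
    if S: "finite S" "S \<subseteq> {g. p * g \<in> Q}" "\<not> S \<subseteq> {0}" for S
  proof
    fix x assume x: "x \<in> divisorial_hull S"
    obtain s where s: "s \<in> S" "s \<noteq> 0" using S(3) by blast
    have "p * x \<in> Q"
    proof (rule proper_t_ideal_hull[OF Q])
      show "finite ((*) p ` S)" "(*) p ` S \<subseteq> Q" "p * s \<in> (*) p ` S" "p * s \<noteq> 0"
        using S s p0 by auto
      show "p * x \<in> divisorial_hull ((*) p ` S)"
      proof (rule divisorial_hullI)
        fix c d :: 'a assume "d \<noteq> 0" "\<And>t. t \<in> (*) p ` S \<Longrightarrow> d dvd c * t"
        then have "d dvd (c * p) * x" by (intro divisorial_hullD[OF x]) (auto simp: mult.assoc)
        then show "d dvd c * (p * x)" by (simp add: mult.assoc)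
      qed
    qed
    then show "x \<in> {g. p * g \<in> Q}" by simp
  qed
  moreover have "z \<in> {g. p * g \<in> Q}" using ideal_mult[OF I z(1)] by simp
  ultimately show ?thesis
    unfolding proper_t_ideal_def using ideal_of_ring_colon[OF I, of p] p z(2) by auto
qed

lemma maximal_t_ideal_prime:
  assumes M: "maximal_t_ideal M" and "p * g \<in> M" and "p \<notin> M"
  shows "g \<in> M"
proof -
  have P: "proper_t_ideal M" by (rule maximal_t_ideal_proper[OF M])
  have "{g. p * g \<in> M} = M"
    by (rule maximal_t_ideal_eq[OF M proper_t_ideal_colon[OF P assms(3)]])
      (use ideal_mult[OF proper_t_ideal_ideal[OF P]] in auto)
  then show ?thesis using assms(2) by blast
qed

text \<open>
  The t-closure of the ideal generated by \<open>C\<close>. It makes sense for an arbitrary set with a nonzero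
  member, so that no generated ideal has to be formed.
\<close>
definition finite_hull :: "'a::idom set \<Rightarrow> 'a set" where
  "finite_hull C = \<Union> {divisorial_hull T | T. finite T \<and> T \<subseteq> C \<and> \<not> T \<subseteq> {0}}"

lemma finite_hullI:
  "finite T \<Longrightarrow> T \<subseteq> C \<Longrightarrow> t \<in> T \<Longrightarrow> t \<noteq> 0 \<Longrightarrow> x \<in> divisorial_hull T \<Longrightarrow> x \<in> finite_hull C"
  unfolding finite_hull_def by blast

lemma finite_hullE:
  assumes "x \<in> finite_hull C"
  obtains T t where "finite T" "T \<subseteq> C" "t \<in> T" "t \<noteq> 0" "x \<in> divisorial_hull T"
  using assms unfolding finite_hull_def by blast

lemma finite_hull_superset:
  assumes "c \<in> C" "c \<noteq> 0"
  shows "C \<subseteq> finite_hull C"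
proof
  fix x assume "x \<in> C"
  then show "x \<in> finite_hull C"
    using assms divisorial_hull_superset[of "{x, c}"] by (intro finite_hullI[of "{x, c}" C c]) auto
qed

text \<open>
  Hulls of finite subsets of \<open>C\<close> are directed, so finitely many members of the t-closure already lie in one
  of them. This is what makes the t-closure idempotent.
\<close>
lemma finite_subset_finite_hull:
  assumes "c \<in> C" "c \<noteq> 0" and "finite S" "S \<subseteq> finite_hull C"
  shows "\<exists>T. finite T \<and> T \<subseteq> C \<and> c \<in> T \<and> S \<subseteq> divisorial_hull T"
  using assms(3,4)
proof (induction S rule: finite_induct)
  case empty
  show ?case using assms(1) by (intro exI[of _ "{c}"]) simp
next
  case (insert x S)
  then obtain T where T: "finite T" "T \<subseteq> C" "c \<in> T" "S \<subseteq> divisorial_hull T" by auto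
  obtain U where U: "finite U" "U \<subseteq> C" "x \<in> divisorial_hull U"
    using insert.prems by (auto elim: finite_hullE)
  have "insert x S \<subseteq> divisorial_hull (T \<union> U)"
    using T(4) U(3) divisorial_hull_mono[of T "T \<union> U"] divisorial_hull_mono[of U "T \<union> U"] by auto
  then show ?case using T U by (intro exI[of _ "T \<union> U"]) auto
qed

lemma proper_t_ideal_finite_hull:
  assumes c: "c \<in> C" "c \<noteq> 0" and one: "1 \<notin> finite_hull C"
  shows "proper_t_ideal (finite_hull C)"
proof -
  have hull: "divisorial_hull S \<subseteq> finite_hull C" if S: "finite S" "S \<subseteq> finite_hull C" for S
  proof -
    obtain T where T: "finite T" "T \<subseteq> C" "c \<in> T" "S \<subseteq> divisorial_hull T" using finite_subset_finite_hull[OF c S] by blast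
    have "divisorial_hull T \<subseteq> finite_hull C" using T c(2) by (auto intro: finite_hullI)
    then show ?thesis using divisorial_hull_idem[OF T(4)] by blast
  qed
  have "ideal_of_ring (finite_hull C)"
  proof (rule ideal_of_ringI)
    show "0 \<in> finite_hull C" using hull[of "{}"] ideal_zero[OF ideal_divisorial_hull] by auto
    show "x + y \<in> finite_hull C" if "x \<in> finite_hull C" "y \<in> finite_hull C" for x y
      using hull[of "{x, y}"] that divisorial_hull_superset[of "{x, y}"]
        ideal_add[OF ideal_divisorial_hull, of x "{x, y}" y] by auto
    show "r * x \<in> finite_hull C" if "x \<in> finite_hull C" for r x
      using hull[of "{x}"] that divisorial_hull_superset[of "{x}"]
        ideal_mult[OF ideal_divisorial_hull, of x "{x}" r] by auto
  qed
  moreover have "finite_hull C \<noteq> {0}" using finite_hull_superset[OF c] c by auto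
  ultimately show ?thesis using one hull by (auto simp: proper_t_ideal_def)
qed

section \<open>Comparison with fractional ideals\<close>

lemma ideal_inv_span: "ideal_inv (fract.span S) = ideal_inv (S :: 'a::idom fract set)"
proof
  show "ideal_inv (fract.span S) \<subseteq> ideal_inv S"
    using fract.span_superset[of S] by (auto simp: ideal_inv_def)
  show "ideal_inv S \<subseteq> ideal_inv (fract.span S)"
  proof
    fix x assume x: "x \<in> ideal_inv S"
    have "x * y \<in> range to_fract" if "y \<in> fract.span S" for y
      using that
    proof (induction y rule: fract.span_induct_alt)
      case base
      show ?case by (rule image_eqI[of _ _ 0]) simp_all
    next
      case (step c u y)
      from step(1) x obtain p where p: "x * u = to_fract p" by (auto simp: ideal_inv_def)
      from step(2) obtain q where q: "x * y = to_fract q" by blast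
      have "x * (fract_scale c u + y) = to_fract (c * p + q)"
        using p q by (simp add: fract_scale_def distrib_left mult.left_commute)
      then show ?case by blast
    qed
    then show "x \<in> ideal_inv (fract.span S)" by (simp add: ideal_inv_def)
  qed
qed

text \<open>
  The v-closure of an integral set is integral because $1$ belongs to the inverse of the set; writing the
  members of the inverse as fractions turns membership into divisibility.
\<close>
lemma v_closure_to_fract: "v_closure (to_fract ` S) = to_fract ` divisorial_hull (S :: 'a::idom set)"
proof
  have mem: "to_fract x * Fract c d \<in> range to_fract \<longleftrightarrow> d dvd c * x"
    if "d \<noteq> 0" for x c d :: 'a
  proof -
    have "to_fract x * Fract c d = to_fract z \<longleftrightarrow> c * x = d * z" for z
      using that by (simp add: to_fract_def eq_fract ac_simps)
    then show ?thesis by (auto simp: dvd_def image_iff)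
  qed
  show "v_closure (to_fract ` S) \<subseteq> to_fract ` divisorial_hull S"
  proof
    fix z assume z: "z \<in> v_closure (to_fract ` S)"
    have "1 \<in> ideal_inv (to_fract ` S)" by (auto simp: ideal_inv_def)
    with z have "z * 1 \<in> range to_fract" unfolding v_closure_def ideal_inv_def by blast
    then obtain x where x: "z = to_fract x" by auto
    have "x \<in> divisorial_hull S"
    proof (rule divisorial_hullI)
      fix c d :: 'a assume d: "d \<noteq> 0" and dvd: "\<And>s. s \<in> S \<Longrightarrow> d dvd c * s"
      have "Fract c d \<in> ideal_inv (to_fract ` S)"
        unfolding ideal_inv_def using mem[OF d] dvd by (auto simp: mult.commute)
      then have "to_fract x * Fract c d \<in> range to_fract"
        using z x by (auto simp: v_closure_def ideal_inv_def)
      then show "d dvd c * x" using mem[OF d] by simp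
    qed
    then show "z \<in> to_fract ` divisorial_hull S" using x by blast
  qed
  show "to_fract ` divisorial_hull S \<subseteq> v_closure (to_fract ` S)"
  proof
    fix z assume "z \<in> to_fract ` divisorial_hull S"
    then obtain x where x: "x \<in> divisorial_hull S" "z = to_fract x" by blast
    have "to_fract x * w \<in> range to_fract" if w: "w \<in> ideal_inv (to_fract ` S)" for w
    proof -
      obtain c d where cd: "w = Fract c d" "d \<noteq> 0" by (cases w)
      have "d dvd c * s" if "s \<in> S" for s
      proof -
        have "w * to_fract s \<in> range to_fract" using w that by (simp add: ideal_inv_def)
        then show ?thesis using mem[OF cd(2), of s c] cd(1) by (simp add: mult.commute)
      qed
      then show ?thesis using divisorial_hullD[OF x(1) cd(2)] mem[OF cd(2)] cd(1) by simp
    qed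
    then show "z \<in> v_closure (to_fract ` S)" using x(2) by (simp add: v_closure_def ideal_inv_def)
  qed
qed

lemma subspace_to_fract_iff:
  "fract.subspace (to_fract ` I) \<longleftrightarrow> ideal_of_ring (I :: 'a::idom set)"
proof -
  have zero: "0 \<in> to_fract ` I \<longleftrightarrow> 0 \<in> I"
    using inj_image_mem_iff[of to_fract 0 I] by (simp add: inj_def)
  have mem: "to_fract x \<in> to_fract ` I \<longleftrightarrow> x \<in> I" for x
    by (rule inj_image_mem_iff) (simp add: inj_def)
  show ?thesis
    unfolding fract.subspace_def ideal_of_ring_def fract_scale_def
    by (simp only: zero ball_simps to_fract_add[symmetric] to_fract_mult[symmetric] mem)
qed

lemma fractional_ideal_to_fract:
  "fractional_ideal (to_fract ` I) \<longleftrightarrow> ideal_of_ring (I :: 'a::idom set)"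
proof -
  have "\<exists>d::'a. d \<noteq> 0 \<and> (\<forall>x\<in>to_fract ` I. to_fract d * x \<in> range to_fract)"
    by (rule exI[of _ 1]) auto
  then show ?thesis by (simp add: fractional_ideal_def subspace_to_fract_iff)
qed

lemma fg_fractional_ideal_span:
  fixes S :: "'a::idom set"
  assumes "finite S"
  shows "fg_fractional_ideal (fract.span (to_fract ` S))"
proof -
  have "fract.span (to_fract ` S) \<subseteq> range to_fract"
    by (rule fract.span_minimal)
      (auto simp: subspace_to_fract_iff ideal_of_ring_def)
  then have "\<forall>x\<in>fract.span (to_fract ` S). to_fract 1 * x \<in> range to_fract" by auto
  then have "fractional_ideal (fract.span (to_fract ` S))"
    unfolding fractional_ideal_def using fract.subspace_span one_neq_zero by blast
  then show ?thesis unfolding fg_fractional_ideal_def using assms by blast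
qed

text \<open>
  A finitely generated fractional ideal inside an integral ideal is generated by finitely many ring
  elements, and passing from generators to their span does not change the inverse.
\<close>
lemma t_closure_to_fract:
  fixes I :: "'a::idom set"
  assumes I: "ideal_of_ring I"
  shows "t_closure (to_fract ` I) = to_fract ` finite_hull I"
proof
  show "t_closure (to_fract ` I) \<subseteq> to_fract ` finite_hull I"
  proof
    fix z assume "z \<in> t_closure (to_fract ` I)"
    then obtain J where J: "fg_fractional_ideal J" "J \<noteq> {0}" "J \<subseteq> to_fract ` I" "z \<in> v_closure J"
      by (auto simp: t_closure_def)
    then obtain G where G: "finite G" "J = fract.span G" by (auto simp: fg_fractional_ideal_def)
    have "G \<subseteq> to_fract ` I" using J(3) G(2) fract.span_superset[of G] by blast
    then obtain S where S: "S \<subseteq> I" "finite S" "G = to_fract ` S"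
      using finite_subset_image[OF G(1)] by metis
    have "\<not> S \<subseteq> {0}"
    proof
      assume "S \<subseteq> {0}"
      then have "G \<subseteq> {0}" using S(3) by auto
      then have "J \<subseteq> {0}" using G(2) fract.span_minimal[of G "{0}"] by (simp add: fract.subspace_single_0)
      then show False using J(2) G(2) fract.span_zero[of G] by auto
    qed
    moreover have "v_closure J = to_fract ` divisorial_hull S"
      using G(2) S(3) by (simp add: v_closure_def ideal_inv_span v_closure_to_fract[unfolded v_closure_def])
    ultimately show "z \<in> to_fract ` finite_hull I"
      using J(4) S by (auto intro!: imageI finite_hullI)
  qed
  show "to_fract ` finite_hull I \<subseteq> t_closure (to_fract ` I)"
  proof
    fix z assume "z \<in> to_fract ` finite_hull I"
    then obtain x T t where x: "z = to_fract x" "x \<in> divisorial_hull T"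
      and T: "finite T" "T \<subseteq> I" "t \<in> T" "t \<noteq> 0" by (auto elim: finite_hullE)
    define J where "J = fract.span (to_fract ` T)"
    have "to_fract t \<in> J" using T(3) by (auto simp: J_def intro: fract.span_base)
    then have "J \<noteq> {0}" using T(4) by auto
    moreover have "J \<subseteq> to_fract ` I"
      unfolding J_def using T(2) I by (intro fract.span_minimal) (auto simp: subspace_to_fract_iff)
    moreover have "z \<in> v_closure J"
      using x v_closure_to_fract[of T] by (simp add: J_def v_closure_def ideal_inv_span)
    ultimately show "z \<in> t_closure (to_fract ` I)"
      using fg_fractional_ideal_span[OF T(1)] by (auto simp: t_closure_def J_def)
  qed
qed

lemma inj_to_fract: "inj (to_fract :: 'a::idom \<Rightarrow> 'a fract)"
  by (simp add: inj_def)

lemma proper_integral_t_ideal_to_fract: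
  fixes I :: "'a::idom set"
  shows "proper_integral_t_ideal (to_fract ` I) \<longleftrightarrow> proper_t_ideal I"
proof (cases "ideal_of_ring I \<and> I \<noteq> {0}")
  case True
  then obtain c where c: "c \<in> I" "c \<noteq> 0" using ideal_zero by blast
  then have "to_fract c \<in> to_fract ` I" "to_fract c \<noteq> 0" by auto
  then have nonzero: "to_fract ` I \<noteq> {0}" by blast
  have "finite_hull I = I \<longleftrightarrow> (\<forall>S. finite S \<longrightarrow> S \<subseteq> I \<longrightarrow> \<not> S \<subseteq> {0} \<longrightarrow> divisorial_hull S \<subseteq> I)"
    using finite_hull_superset[OF c] unfolding finite_hull_def by blast
  moreover have "to_fract ` I \<subset> range to_fract \<longleftrightarrow> 1 \<notin> I"
  proof -
    have "I = UNIV \<longleftrightarrow> 1 \<in> I" using True ideal_mult[of I 1] by auto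
    moreover have "to_fract ` I = range to_fract \<longleftrightarrow> I = UNIV"
      by (rule inj_image_eq_iff[OF inj_to_fract])
    ultimately show ?thesis by auto
  qed
  ultimately show ?thesis
    using True nonzero
    by (auto simp: proper_integral_t_ideal_def t_ideal_def proper_t_ideal_def fractional_ideal_to_fract
        t_closure_to_fract inj_image_eq_iff[OF inj_to_fract])
next
  case False
  moreover have "to_fract ` I \<noteq> {0} \<longleftrightarrow> I \<noteq> {0}"
    using inj_image_eq_iff[OF inj_to_fract, of I "{0}"] by simp
  ultimately show ?thesis
    by (auto simp: proper_integral_t_ideal_def t_ideal_def proper_t_ideal_def fractional_ideal_to_fract)
qed

lemma t_maximal_ideal_to_fract:
  fixes I :: "'a::idom set"
  shows "t_maximal_ideal (to_fract ` I) \<longleftrightarrow> maximal_t_ideal I"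
proof -
  have "(\<forall>N. proper_integral_t_ideal N \<longrightarrow> to_fract ` I \<subseteq> N \<longrightarrow> N = to_fract ` I) \<longleftrightarrow>
        (\<forall>N. proper_t_ideal N \<longrightarrow> I \<subseteq> N \<longrightarrow> N = I)" (is "?L = ?R")
  proof
    assume L: ?L
    show ?R
    proof (intro allI impI)
      fix N assume "proper_t_ideal N" "I \<subseteq> N"
      then have "to_fract ` N = to_fract ` I"
        using L by (simp add: proper_integral_t_ideal_to_fract image_mono)
      then show "N = I" by (simp only: inj_image_eq_iff[OF inj_to_fract])
    qed
  next
    assume R: ?R
    show ?L
    proof (intro allI impI)
      fix N assume N: "proper_integral_t_ideal N" "to_fract ` I \<subseteq> N"
      then obtain N' where N': "N = to_fract ` N'"
        by (metis proper_integral_t_ideal_def psubset_imp_subset subset_imageE)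
      have "proper_t_ideal N'" "I \<subseteq> N'"
        using N N' by (simp_all add: proper_integral_t_ideal_to_fract inj_image_subset_iff[OF inj_to_fract])
      then show "N = to_fract ` I" using R N' by blast
    qed
  qed
  then show ?thesis
    by (simp add: t_maximal_ideal_def maximal_t_ideal_def proper_integral_t_ideal_to_fract)
qed

lemma finite_t_character_iff:
  "finite_t_character TYPE('a::idom) \<longleftrightarrow>
     (\<forall>a::'a. a \<noteq> 0 \<longrightarrow> \<not> a dvd 1 \<longrightarrow> finite {M. maximal_t_ideal M \<and> a \<in> M})"
proof -
  have "{M. t_maximal_ideal M \<and> to_fract a \<in> M} = (`) to_fract ` {M. maximal_t_ideal M \<and> a \<in> M}"
    for a :: 'a
  proof
    show "{M. t_maximal_ideal M \<and> to_fract a \<in> M} \<subseteq> (`) to_fract ` {M. maximal_t_ideal M \<and> a \<in> M}"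
    proof
      fix M assume M: "M \<in> {M. t_maximal_ideal M \<and> to_fract a \<in> M}"
      then have "M \<subseteq> range to_fract"
        by (auto simp: t_maximal_ideal_def proper_integral_t_ideal_def)
      then obtain I where "M = to_fract ` I" by (auto elim: subset_imageE)
      then show "M \<in> (`) to_fract ` {M. maximal_t_ideal M \<and> a \<in> M}"
        using M by (auto simp: t_maximal_ideal_to_fract inj_image_mem_iff[OF inj_to_fract])
    qed
  qed (auto simp: t_maximal_ideal_to_fract)
  moreover have "inj ((`) (to_fract :: 'a \<Rightarrow> 'a fract))"
    by (auto simp: inj_def inj_image_eq_iff[OF inj_to_fract])
  then have "finite ((`) to_fract ` \<M>) \<longleftrightarrow> finite \<M>" for \<M> :: "'a set set"
    by (meson finite_image_iff inj_on_subset subset_UNIV)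
  ultimately show ?thesis by (simp add: finite_t_character_def)
qed

section \<open>t-ideals of a polynomial ring\<close>

definition poly_extension :: "'a::idom set \<Rightarrow> 'a poly set" where
  "poly_extension I = {p. \<forall>i. coeff p i \<in> I}"

lemma const_in_poly_extension_iff:
  "ideal_of_ring I \<Longrightarrow> [:a:] \<in> poly_extension I \<longleftrightarrow> a \<in> I"
  by (auto simp: poly_extension_def coeff_pCons ideal_zero split: nat.splits)

lemma coeff_mult_in_ideal:
  assumes "ideal_of_ring I" "\<And>i. coeff p i \<in> I"
  shows "coeff (r * p) i \<in> I"
proof -
  have "sum f A \<in> I" if "finite A" "\<And>x. x \<in> A \<Longrightarrow> f x \<in> I" for A and f :: "nat \<Rightarrow> 'a"
    using that by (induction A rule: finite_induct) (auto simp: ideal_zero[OF assms(1)] ideal_add[OF assms(1)])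
  from this[of "{..i}" "\<lambda>j. coeff r j * coeff p (i - j)"] show ?thesis
    using ideal_mult[OF assms(1) assms(2)] by (simp add: coeff_mult)
qed

text \<open>
  Testing the hull of a finite set of polynomials against constant fractions $c/d$ only shows that
  the coefficients of its members lie in the hull of the finitely many coefficients of the set.
\<close>
lemma proper_t_ideal_poly_extension:
  assumes M: "proper_t_ideal M"
  shows "proper_t_ideal (poly_extension M)"
proof -
  have I: "ideal_of_ring M" by (rule proper_t_ideal_ideal[OF M])
  obtain z where z: "z \<in> M" "z \<noteq> 0" using proper_t_ideal_nonzero[OF M] .
  have "ideal_of_ring (poly_extension M)"
    by (rule ideal_of_ringI)
      (auto simp: poly_extension_def ideal_zero[OF I] ideal_add[OF I] coeff_mult_in_ideal[OF I])
  moreover have "[:z:] \<in> poly_extension M" using z(1) I by (simp add: const_in_poly_extension_iff)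
  then have "poly_extension M \<noteq> {0}" using z(2) by auto
  moreover have "1 \<notin> poly_extension M"
    using proper_t_ideal_one[OF M] const_in_poly_extension_iff[OF I, of 1] by (simp add: one_pCons)
  moreover have "divisorial_hull S \<subseteq> poly_extension M"
    if S: "finite S" "S \<subseteq> poly_extension M" "\<not> S \<subseteq> {0}" for S
  proof
    fix x assume x: "x \<in> divisorial_hull S"
    define T where "T = (\<Union>p\<in>S. range (coeff p))"
    obtain s where s: "s \<in> S" "s \<noteq> 0" using S(3) by blast
    have "coeff x k \<in> M" for k
    proof (rule proper_t_ideal_hull[OF M])
      show "finite T" "T \<subseteq> M" using S finite_range_coeff by (auto simp: T_def poly_extension_def)
      show "lead_coeff s \<in> T" "lead_coeff s \<noteq> 0" using s by (auto simp: T_def)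
      show "coeff x k \<in> divisorial_hull T"
      proof (rule divisorial_hullI)
        fix c d :: 'a assume d: "d \<noteq> 0" and dvd: "\<And>t. t \<in> T \<Longrightarrow> d dvd c * t"
        have "[:d:] dvd [:c:] * x"
          using d dvd by (intro divisorial_hullD[OF x]) (auto simp: const_poly_dvd_iff T_def)
        then show "d dvd c * coeff x k" by (auto simp: const_poly_dvd_iff)
      qed
    qed
    then show "x \<in> poly_extension M" by (simp add: poly_extension_def)
  qed
  ultimately show ?thesis by (simp add: proper_t_ideal_def)
qed

text \<open>
  The ideal \<open>N\<close> is the t-closure of the set of all coefficients of members of \<open>Q\<close>; the content of the lemma
  is that it is proper. Otherwise $1$ lies in the hull of finitely many coefficients, and then
  also in the hull of the polynomials \<open>S\<close> that they come from together with the constant $a$: a fraction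
  $g/d$ in the inverse of these equals $h/a$ for some polynomial $h$, because it multiplies $a$
  into $R[X]$, and by Gauss's lemma above $a$ divides the product of any coefficient of $h$ with
  any of the chosen ones. So $a$ divides $h$, and $g/d$ is a polynomial.
\<close>
lemma t_ideal_with_constant_le_poly_extension:
  fixes Q :: "'a::idom poly set"
  assumes closed: "integrally_closed TYPE('a)" and Q: "proper_t_ideal Q"
    and a: "[:a:] \<in> Q" "a \<noteq> 0"
  obtains N where "proper_t_ideal N" "Q \<subseteq> poly_extension N"
proof (rule that)
  define C where "C = (\<lambda>(p, i). coeff p i) ` (Q \<times> UNIV)"
  have C: "coeff p i \<in> C" if "p \<in> Q" for p i
    unfolding C_def by (rule image_eqI[of _ _ "(p, i)"]) (simp_all add: that)
  have aC: "a \<in> C" using C[OF a(1), of 0] by simp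
  show "Q \<subseteq> poly_extension (finite_hull C)"
  proof
    fix p assume p: "p \<in> Q"
    have "coeff p i \<in> finite_hull C" for i
      using finite_hull_superset[OF aC a(2)] C[OF p] by (rule subsetD)
    then show "p \<in> poly_extension (finite_hull C)" by (simp add: poly_extension_def)
  qed
  show "proper_t_ideal (finite_hull C)"
  proof (rule proper_t_ideal_finite_hull[OF aC a(2)], rule notI)
    assume "1 \<in> finite_hull C"
    then obtain T t where T: "finite T" "T \<subseteq> C" "1 \<in> divisorial_hull T" by (rule finite_hullE)
    obtain U where U: "U \<subseteq> Q \<times> UNIV" "finite U" "T = (\<lambda>(p, i). coeff p i) ` U"
      using finite_subset_image[OF T(1) T(2)[unfolded C_def]] by metis
    define S where "S = fst ` U"
    have S: "finite S" "S \<subseteq> Q" using U(1,2) by (auto simp: S_def)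
    have "1 \<in> divisorial_hull (insert [:a:] S)"
    proof (rule divisorial_hullI)
      fix g d :: "'a poly"
      assume d: "d \<noteq> 0" and dvd: "\<And>s. s \<in> insert [:a:] S \<Longrightarrow> d dvd g * s"
      obtain h where h: "g * [:a:] = d * h" using dvd[OF insertI1] by (rule dvdE)
      have "a dvd coeff h i * t" if t: "t \<in> T" for i t
      proof -
        obtain s j where sj: "(s, j) \<in> U" "t = coeff s j" using t U(3) by auto
        have s: "s \<in> S" using imageI[OF sj(1), of fst] by (simp add: S_def)
        obtain k where k: "g * s = d * k" using dvd[OF insertI2[OF s]] by (rule dvdE)
        have "d * (h * s) = g * [:a:] * s" by (simp only: h mult.assoc)
        also have "\<dots> = [:a:] * (g * s)" by (simp only: ac_simps)
        also have "\<dots> = d * ([:a:] * k)" by (simp only: k ac_simps)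
        finally have "h * s = [:a:] * k" by (rule mult_left_cancel[THEN iffD1, OF d])
        then have "[:a:] dvd h * s" by (rule dvdI)
        then show ?thesis unfolding sj(2) by (rule const_dvd_mult_imp_dvd_coeff_mult[OF closed a(2)])
      qed
      then have "a dvd coeff h i * 1" for i by (rule divisorial_hullD[OF T(3) a(2)])
      then have "[:a:] dvd h" by (simp add: const_poly_dvd_iff)
      then obtain k where "h = [:a:] * k" by (rule dvdE)
      then have "[:a:] * g = [:a:] * (d * k)" using h by (simp only: mult_ac)
      moreover have "[:a:] \<noteq> 0" using a(2) by simp
      ultimately have "g = d * k" by (rule mult_left_cancel[THEN iffD1, rotated])
      then show "d dvd g * 1" by simp
    qed
    then have "1 \<in> Q"
      using S(1,2) a by (intro proper_t_ideal_hull[OF Q, of "insert [:a:] S" "[:a:]"]) simp_all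
    then show False using proper_t_ideal_one[OF Q] by simp
  qed
qed

text \<open>
  A proper t-ideal above $M[X]$ contains the nonzero constants of $M$, so it lies in some $N[X]$, where
  $N \supseteq M$ must be $M$.
\<close>
lemma maximal_t_ideal_poly_extension:
  fixes M :: "'a::idom set"
  assumes closed: "integrally_closed TYPE('a)" and M: "maximal_t_ideal M"
  shows "maximal_t_ideal (poly_extension M)"
  unfolding maximal_t_ideal_def
proof (intro conjI allI impI)
  have P: "proper_t_ideal M" by (rule maximal_t_ideal_proper[OF M])
  note I = proper_t_ideal_ideal[OF P]
  show "proper_t_ideal (poly_extension M)" by (rule proper_t_ideal_poly_extension[OF P])
  fix Q assume Q: "proper_t_ideal Q" and le: "poly_extension M \<subseteq> Q"
  obtain z where z: "z \<in> M" "z \<noteq> 0" using proper_t_ideal_nonzero[OF P] .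
  have zQ: "[:z:] \<in> Q" using le z(1) const_in_poly_extension_iff[OF I, of z] by auto
  obtain N where N: "proper_t_ideal N" "Q \<subseteq> poly_extension N"
    using t_ideal_with_constant_le_poly_extension[OF closed Q zQ z(2)] .
  have "M \<subseteq> N"
  proof
    fix x assume "x \<in> M"
    then have "[:x:] \<in> poly_extension N"
      using le N(2) const_in_poly_extension_iff[OF I, of x] by auto
    then show "x \<in> N" by (simp add: const_in_poly_extension_iff[OF proper_t_ideal_ideal[OF N(1)]])
  qed
  then have "N = M" by (rule maximal_t_ideal_eq[OF M N(1)])
  with N(2) have "Q \<subseteq> poly_extension M" by simp
  then show "Q = poly_extension M" using le by (rule subset_antisym)
qed

lemma poly_extension_mono: "I \<subseteq> J \<Longrightarrow> poly_extension I \<subseteq> poly_extension J"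
  by (auto simp: poly_extension_def)

lemma poly_extension_inj:
  assumes "ideal_of_ring I" "ideal_of_ring J" "poly_extension I = poly_extension J"
  shows "I = J"
proof (rule Set.set_eqI)
  show "x \<in> I \<longleftrightarrow> x \<in> J" for x
    using const_in_poly_extension_iff[OF assms(1), of x] const_in_poly_extension_iff[OF assms(2), of x]
      assms(3) by simp
qed

lemma maximal_t_ideal_with_constant:
  fixes Q :: "'a::idom poly set"
  assumes closed: "integrally_closed TYPE('a)" and Q: "maximal_t_ideal Q"
    and a: "[:a:] \<in> Q" "a \<noteq> 0"
  obtains N where "maximal_t_ideal N" "Q = poly_extension N"
proof -
  obtain N where N: "proper_t_ideal N" "Q \<subseteq> poly_extension N"
    using t_ideal_with_constant_le_poly_extension[OF closed maximal_t_ideal_proper[OF Q] a] .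
  have Q_eq: "poly_extension N' = Q" if "proper_t_ideal N'" "N \<subseteq> N'" for N'
    using Q proper_t_ideal_poly_extension[OF that(1)] subset_trans[OF N(2) poly_extension_mono[OF that(2)]]
    by (rule maximal_t_ideal_eq)
  have "N' = N" if "proper_t_ideal N'" "N \<subseteq> N'" for N'
    by (rule poly_extension_inj)
      (simp_all add: Q_eq[OF that] Q_eq[OF N(1) order_refl] proper_t_ideal_ideal that(1) N(1))
  then have "maximal_t_ideal N" using N(1) by (simp add: maximal_t_ideal_def)
  then show thesis using Q_eq[OF N(1) order_refl, symmetric] by (rule that)
qed

definition contracts_to_zero :: "'a::idom poly set \<Rightarrow> bool" where
  "contracts_to_zero Q \<longleftrightarrow> (\<forall>a. [:a:] \<in> Q \<longrightarrow> a = 0)"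

text \<open>
  Over the quotient field of $R$ each of these ideals is generated by an irreducible factor of $f$. The
  induction on the degree splits off one factor at a time; instead of unique factorization it uses
  that maximal t-ideals are prime.
\<close>
lemma finite_maximal_t_ideals_over_zero:
  fixes f :: "'a::idom poly"
  assumes "f \<noteq> 0"
  shows "finite {Q. maximal_t_ideal Q \<and> contracts_to_zero Q \<and> f \<in> Q}"
  using assms
proof (induction "degree f" arbitrary: f rule: less_induct)
  case less
  show ?case
  proof (cases "{Q. maximal_t_ideal Q \<and> contracts_to_zero Q \<and> f \<in> Q} = {}")
    case False
    then obtain Q1 where Q1: "maximal_t_ideal Q1" "contracts_to_zero Q1" "f \<in> Q1" by blast
    have I1: "ideal_of_ring Q1" using Q1(1) by (simp add: maximal_t_ideal_proper proper_t_ideal_ideal)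
    (* A member of least degree generates Q1 up to constant factors. *)
    define p where "p = arg_min degree (\<lambda>p. p \<in> Q1 \<and> p \<noteq> 0)"
    have p: "p \<in> Q1" "p \<noteq> 0"
      using arg_min_natI[of "\<lambda>p. p \<in> Q1 \<and> p \<noteq> 0" f degree] Q1(3) less.prems by (auto simp: p_def)
    have p_min: "degree p \<le> degree q" if "q \<in> Q1" "q \<noteq> 0" for q
      using arg_min_nat_le[of "\<lambda>p. p \<in> Q1 \<and> p \<noteq> 0" q degree] that by (auto simp: p_def)
    have deg_p: "degree p > 0"
    proof (rule ccontr)
      assume "\<not> degree p > 0"
      then have "degree p = 0" by simp
      then obtain c where "p = [:c:]" by (rule degree_eq_zeroE)
      then show False using p Q1(2) by (auto simp: contracts_to_zero_def)
    qed
    have divides: "\<exists>b q. b \<noteq> 0 \<and> [:b:] * g = p * q" if g: "g \<in> Q1" for g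
    proof -
      obtain b q where bq: "b \<noteq> 0" "Polynomial.smult b g = p * q + pseudo_mod g p"
        using pseudo_mod(1)[OF p(2), of g] by blast
      have "pseudo_mod g p = [:b:] * g - q * p" using bq(2) by (simp add: algebra_simps)
      also have "\<dots> \<in> Q1" using g p(1) by (intro ideal_diff[OF I1] ideal_mult[OF I1])
      finally have "pseudo_mod g p = 0" using pseudo_mod(2)[OF p(2), of g] p_min by fastforce
      then show ?thesis using bq by auto
    qed
    obtain b f' where f': "b \<noteq> 0" "[:b:] * f = p * f'" using divides[OF Q1(3)] by blast
    have f'0: "f' \<noteq> 0" using f' less.prems by auto
    have "degree f = degree p + degree f'"
      using arg_cong[OF f'(2), of degree] f' p(2) f'0 by (simp add: degree_mult_eq)
    then have "finite {Q. maximal_t_ideal Q \<and> contracts_to_zero Q \<and> f' \<in> Q}"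
      using deg_p f'0 by (intro less.hyps) auto
    (* If Q contains p it contains b * g for each g in Q1, hence g itself; otherwise primality
       cancels p from p * f' = b * f. *)
    moreover have "Q = Q1 \<or> f' \<in> Q"
      if Q: "maximal_t_ideal Q" "contracts_to_zero Q" "f \<in> Q" for Q
    proof (cases "p \<in> Q")
      case True
      note I = proper_t_ideal_ideal[OF maximal_t_ideal_proper[OF Q(1)]]
      have "Q1 \<subseteq> Q"
      proof
        fix g assume "g \<in> Q1"
        then obtain b q where bq: "b \<noteq> 0" "[:b:] * g = p * q" using divides by blast
        have "[:b:] * g \<in> Q" using bq(2) ideal_mult[OF I True, of q] by (simp only: mult.commute)
        moreover have "[:b:] \<notin> Q" using bq(1) Q(2) by (auto simp: contracts_to_zero_def)
        ultimately show "g \<in> Q" by (rule maximal_t_ideal_prime[OF Q(1)])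
      qed
      then show ?thesis using maximal_t_ideal_eq[OF Q1(1) maximal_t_ideal_proper[OF Q(1)]] by blast
    next
      case False
      have "p * f' \<in> Q"
        using ideal_mult[OF proper_t_ideal_ideal[OF maximal_t_ideal_proper[OF Q(1)]] Q(3)] f'(2) by metis
      then show ?thesis using maximal_t_ideal_prime[OF Q(1) _ False] by blast
    qed
    then have "{Q. maximal_t_ideal Q \<and> contracts_to_zero Q \<and> f \<in> Q}
        \<subseteq> insert Q1 {Q. maximal_t_ideal Q \<and> contracts_to_zero Q \<and> f' \<in> Q}" by blast
    ultimately show ?thesis by (meson finite.insertI finite_subset)
  next
    case True
    then show ?thesis by (simp only: finite.emptyI)
  qed
qed

theorem proposition4p2:
  assumes "integrally_closed TYPE('a::idom)"
  shows "finite_t_character TYPE('a) \<longleftrightarrow> finite_t_character TYPE('a poly)"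
proof
  assume R: "finite_t_character TYPE('a)"
  show "finite_t_character TYPE('a poly)"
    unfolding finite_t_character_iff
  proof (intro allI impI)
    fix f :: "'a poly" assume f: "f \<noteq> 0"
    (* Any nonzero coefficient would do: all of them lie in M when f lies in M[X]. *)
    define c where "c = lead_coeff f"
    have c0: "c \<noteq> 0" using f by (simp add: c_def)
    (* The hypothesis speaks of nonunits only, but a unit lies in no proper ideal. *)
    have "finite {M. maximal_t_ideal M \<and> c \<in> M}"
    proof (cases "c dvd 1")
      case True
      have "c \<notin> M" if M: "maximal_t_ideal M" for M
      proof
        assume "c \<in> M"
        moreover obtain d where "1 = d * c" using True by (metis dvdE mult.commute)
        ultimately have "1 \<in> M"
          using ideal_mult[OF proper_t_ideal_ideal[OF maximal_t_ideal_proper[OF M]], of c d] by simp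
        then show False using proper_t_ideal_one[OF maximal_t_ideal_proper[OF M]] by simp
      qed
      then have "{M. maximal_t_ideal M \<and> c \<in> M} = {}" by blast
      then show ?thesis by (simp only: finite.emptyI)
    qed (use R c0 in \<open>auto simp: finite_t_character_iff\<close>)
    moreover have "{Q. maximal_t_ideal Q \<and> f \<in> Q}
        \<subseteq> poly_extension ` {M. maximal_t_ideal M \<and> c \<in> M}
          \<union> {Q. maximal_t_ideal Q \<and> contracts_to_zero Q \<and> f \<in> Q}"
    proof
      fix Q assume "Q \<in> {Q. maximal_t_ideal Q \<and> f \<in> Q}"
      then have Q: "maximal_t_ideal Q" "f \<in> Q" by auto
      show "Q \<in> poly_extension ` {M. maximal_t_ideal M \<and> c \<in> M}
          \<union> {Q. maximal_t_ideal Q \<and> contracts_to_zero Q \<and> f \<in> Q}"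
      proof (cases "contracts_to_zero Q")
        case False
        then obtain a where a: "[:a:] \<in> Q" "a \<noteq> 0" by (auto simp: contracts_to_zero_def)
        obtain N where "maximal_t_ideal N" "Q = poly_extension N"
          using maximal_t_ideal_with_constant[OF assms Q(1) a] .
        then show ?thesis using Q(2) by (auto simp: c_def poly_extension_def)
      qed (use Q in simp)
    qed
    ultimately show "finite {Q. maximal_t_ideal Q \<and> f \<in> Q}"
      using finite_maximal_t_ideals_over_zero[OF f] by (meson finite_UnI finite_imageI finite_subset)
  qed
next
  assume RX: "finite_t_character TYPE('a poly)"
  show "finite_t_character TYPE('a)"
    unfolding finite_t_character_iff
  proof (intro allI impI)
    fix a :: 'a assume a: "a \<noteq> 0" "\<not> a dvd 1"
    have "\<not> [:a:] dvd 1" using a(2) by (simp add: is_unit_const_poly_iff)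
    then have "finite {Q. maximal_t_ideal Q \<and> [:a:] \<in> Q}"
      using RX a(1) by (simp add: finite_t_character_iff)
    moreover have "poly_extension ` {M. maximal_t_ideal M \<and> a \<in> M} \<subseteq> {Q. maximal_t_ideal Q \<and> [:a:] \<in> Q}"
      using maximal_t_ideal_poly_extension[OF assms]
      by (auto simp: const_in_poly_extension_iff proper_t_ideal_ideal maximal_t_ideal_proper)
    ultimately have "finite (poly_extension ` {M. maximal_t_ideal M \<and> a \<in> M})"
      by (rule finite_subset[rotated])
    moreover have "inj_on poly_extension {M. maximal_t_ideal M \<and> a \<in> M}"
      by (rule inj_onI, rule poly_extension_inj)
        (simp_all add: proper_t_ideal_ideal maximal_t_ideal_proper)
    ultimately show "finite {M. maximal_t_ideal M \<and> a \<in> M}" by (rule finite_imageD)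
  qed
qed

end
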